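(* Let $h\colon\mathcal{X}\to\mathcal{Y}$ be a classifier with conditional risk $r(x)=\sum_{y\in\mathcal{Y}}p(y\mid x)\,\ell(y,h(x))$, let $n\ge 2$, and let $E_{\rm proxy}(s)$ be the expectation of the smooth SELE proxy $\psi_{\rm sele}(s,\mathcal{T}_n)$ over $n$ i.i.d. examples from $p(x,y)$. Let $s^*\colon\mathcal{X}\to\mathbb{R}$ be an optimal solution to $\min_{s\colon\mathcal{X}\to\mathbb{R}}E_{\rm proxy}(s)$. Then the condition $$\forall (x,x')\in\mathcal{X}\times\mathcal{X}:\ r(x)<r(x')\Rightarrow s^*(x)<s^*(x')$$ is satisfied almost surely, i.e. the set of pairs $(x,x')\in\mathcal{X}\times\mathcal{X}$ with $r(x)<r(x')$ and $s^*(x)\ge s^*(x')$ has probability zero when $x,x'$ are drawn independently from $p(x)$.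
   Context: $\mathcal{X}$ is a set of inputs (a measurable space with a fixed reference measure $dx$), $\mathcal{Y}$ is a finite set of labels, $p(x,y)$ is a probability density on $\mathcal{X}\times\mathcal{Y}$ (with respect to $dx$ times counting measure), $p(x)=\sum_{y\in\mathcal{Y}}p(x,y)$ is its marginal, and $p(y\mid x)$ is the conditional distribution, so $p(x,y)=p(x)p(y\mid x)$. $\ell\colon\mathcal{Y}\times\mathcal{Y}\to[0,\infty)$ is a loss. All functions are taken measurable. For $\mathcal{T}_n=\{(x_i,y_i)\mid i=1,\ldots,n\}$, $$\psi_{\rm sele}(s,\mathcal{T}_n)=\frac1{n^2}\sum_{i=1}^n\sum_{j=1}^n\ell(y_i,h(x_i))\log\big(1+\exp(s(x_j)-s(x_i))\big),$$ and $$E_{\rm proxy}(s)=\int_{\mathcal{X}^n}\sum_{(y_1,\ldots,y_n)\in\mathcal{Y}^n}\prod_{i=1}^n p(x_i,y_i)\,\psi_{\rm sele}(s,\mathcal{T}_n)\,dx_1\cdots dx_n$$ $$=\frac{n^2-n}{n^2}\int_{\mathcal{X}}p(x)r(x)\Big(\int_{\mathcal{X}}p(z)\log\big(1+\exp(s(z)-s(x))\big)\,dz\Big)dx+\frac{\log 2}{n}\int_{\mathcal{X}}p(x)r(x)\,dx .$$ *)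

theory Defs
  imports "HOL-Probability.Probability"
begin

text \<open>
  \<open>p :: 'a \<Rightarrow> 'b \<Rightarrow> real\<close> is a density with respect to the product of the reference measure \<open>M\<close>
  on the inputs and the counting measure on the finite label type \<open>'b\<close>.
\<close>

definition joint_density :: "'a measure \<Rightarrow> ('a \<Rightarrow> 'b::finite \<Rightarrow> real) \<Rightarrow> bool" where
  "joint_density M p \<longleftrightarrow>
     (\<lambda>(x, y). p x y) \<in> borel_measurable (M \<Otimes>\<^sub>M count_space UNIV) \<and>
     (\<forall>x\<in>space M. \<forall>y. 0 \<le> p x y) \<and>
     (\<integral>\<^sup>+ (x, y). ennreal (p x y) \<partial>(M \<Otimes>\<^sub>M count_space UNIV)) = 1"

definition joint_distr :: "'a measure \<Rightarrow> ('a \<Rightarrow> 'b::finite \<Rightarrow> real) \<Rightarrow> ('a \<times> 'b) measure" where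
  "joint_distr M p = density (M \<Otimes>\<^sub>M count_space UNIV) (\<lambda>(x, y). ennreal (p x y))"

definition marginal :: "('a \<Rightarrow> 'b::finite \<Rightarrow> real) \<Rightarrow> 'a \<Rightarrow> real" where
  "marginal p x = (\<Sum>y\<in>UNIV. p x y)"

definition input_distr :: "'a measure \<Rightarrow> ('a \<Rightarrow> 'b::finite \<Rightarrow> real) \<Rightarrow> 'a measure" where
  "input_distr M p = density M (\<lambda>x. ennreal (marginal p x))"

text \<open>
  By division by zero, the conditional is \<open>0\<close> where the marginal density vanishes; these inputs
  form a null set of \<open>input_distr M p\<close>.
\<close>

definition cond_prob_label :: "('a \<Rightarrow> 'b::finite \<Rightarrow> real) \<Rightarrow> 'a \<Rightarrow> 'b \<Rightarrow> real" where
  "cond_prob_label p x y = p x y / marginal p x"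

definition cond_risk ::
  "('a \<Rightarrow> 'b::finite \<Rightarrow> real) \<Rightarrow> ('b \<Rightarrow> 'b \<Rightarrow> real) \<Rightarrow> ('a \<Rightarrow> 'b) \<Rightarrow> 'a \<Rightarrow> real" where
  "cond_risk p loss h x = (\<Sum>y\<in>UNIV. cond_prob_label p x y * loss y (h x))"

definition psi_sele ::
  "nat \<Rightarrow> ('b \<Rightarrow> 'b \<Rightarrow> real) \<Rightarrow> ('a \<Rightarrow> 'b) \<Rightarrow> ('a \<Rightarrow> real) \<Rightarrow> (nat \<Rightarrow> 'a \<times> 'b) \<Rightarrow> real" where
  "psi_sele n loss h s T =
     1 / (real n)\<^sup>2 * (\<Sum>i=1..n. \<Sum>j=1..n.
       loss (snd (T i)) (h (fst (T i))) * ln (1 + exp (s (fst (T j)) - s (fst (T i)))))"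

text \<open>
  The expectation is taken in \<open>[0, \<infinity>]\<close>: the Bochner integral would assign the value \<open>0\<close> to
  scores \<open>s\<close> with infinite expected proxy loss and thereby turn them into minimizers.
\<close>

definition E_proxy ::
  "'a measure \<Rightarrow> ('a \<Rightarrow> 'b::finite \<Rightarrow> real) \<Rightarrow> ('b \<Rightarrow> 'b \<Rightarrow> real) \<Rightarrow> ('a \<Rightarrow> 'b) \<Rightarrow> nat \<Rightarrow>
   ('a \<Rightarrow> real) \<Rightarrow> ennreal" where
  "E_proxy M p loss h n s =
     (\<integral>\<^sup>+ T. ennreal (psi_sele n loss h s T) \<partial>(\<Pi>\<^sub>M i\<in>{1..n}. joint_distr M p))"

lemma joint_densityD:
  assumes "joint_density M p"
  shows "(\<lambda>(x, y). p x y) \<in> borel_measurable (M \<Otimes>\<^sub>M count_space UNIV)"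
    and "x \<in> space M \<Longrightarrow> 0 \<le> p x y"
    and "(\<integral>\<^sup>+ (x, y). ennreal (p x y) \<partial>(M \<Otimes>\<^sub>M count_space UNIV)) = 1"
  using assms by (auto simp: joint_density_def)

lemma marginal_times_cond:
  assumes "joint_density M p" "x \<in> space M"
  shows "p x y = marginal p x * cond_prob_label p x y"
proof (cases "marginal p x = 0")
  case True
  then have "p x y = 0"
    using joint_densityD(2)[OF assms] by (simp add: marginal_def sum_nonneg_eq_0_iff)
  then show ?thesis using True by simp
qed (simp add: cond_prob_label_def)

lemma sets_joint_distr [measurable_cong, simp]:
  "sets (joint_distr M p) = sets (M \<Otimes>\<^sub>M count_space UNIV)"
  by (simp add: joint_distr_def)

lemma prob_space_joint_distr:
  assumes "joint_density M p"
  shows "prob_space (joint_distr M p)"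
proof
  have "(\<lambda>(x, y). ennreal (p x y)) \<in> borel_measurable (M \<Otimes>\<^sub>M count_space UNIV)"
    using measurable_compose[OF joint_densityD(1)[OF assms] measurable_ennreal]
    by (simp add: split_beta')
  then have "emeasure (joint_distr M p) (space (M \<Otimes>\<^sub>M count_space UNIV)) =
      (\<integral>\<^sup>+ z. (case z of (x, y) \<Rightarrow> ennreal (p x y)) \<partial>(M \<Otimes>\<^sub>M count_space UNIV))"
    unfolding joint_distr_def
    by (subst emeasure_density) (auto intro!: nn_integral_cong)
  then show "emeasure (joint_distr M p) (space (joint_distr M p)) = 1"
    using joint_densityD(3)[OF assms] by (simp add: joint_distr_def)
qed

lemma nn_integral_joint_distr:
  fixes p :: "'a \<Rightarrow> 'b::finite \<Rightarrow> real"
  assumes p: "joint_density M p"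
    and f [measurable]: "f \<in> borel_measurable (M \<Otimes>\<^sub>M count_space UNIV)"
  shows "(\<integral>\<^sup>+ z. f z \<partial>joint_distr M p) = (\<integral>\<^sup>+ x. (\<Sum>y\<in>UNIV. ennreal (p x y) * f (x, y)) \<partial>M)"
proof -
  interpret C: sigma_finite_measure "count_space (UNIV :: 'b set)"
    by (rule sigma_finite_measure_count_space_finite) simp
  have [measurable]: "(\<lambda>(x, y). p x y) \<in> borel_measurable (M \<Otimes>\<^sub>M count_space UNIV)"
    by (rule joint_densityD(1)[OF p])
  show ?thesis
    unfolding joint_distr_def
    by (subst nn_integral_density, measurable, subst C.nn_integral_fst[symmetric], measurable)
       (simp add: nn_integral_count_space_finite)
qed

lemma nn_integral_PiM_joint_distr:
  fixes p :: "'a \<Rightarrow> 'b::finite \<Rightarrow> real" and I :: "'i set"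
  assumes M: "sigma_finite_measure M" and p: "joint_density M p" and "finite I"
    and "f \<in> borel_measurable (\<Pi>\<^sub>M i\<in>I. (M \<Otimes>\<^sub>M count_space UNIV))"
  shows "(\<integral>\<^sup>+ T. f T \<partial>(\<Pi>\<^sub>M i\<in>I. joint_distr M p)) =
    (\<integral>\<^sup>+ x. (\<Sum>y\<in>I \<rightarrow>\<^sub>E UNIV. (\<Prod>i\<in>I. ennreal (p (x i) (y i))) * f (\<lambda>i\<in>I. (x i, y i)))
      \<partial>(\<Pi>\<^sub>M i\<in>I. M))"
  using assms(3,4)
proof (induction I arbitrary: f rule: finite_induct)
  case empty
  have "(\<lambda>x. undefined) = (\<lambda>i\<in>{}. (undefined, undefined))" by auto
  then show ?case
    by (simp add: PiM_empty nn_integral_count_space_finite)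
next
  case (insert k I)
  note f [measurable] = insert.prems
  have pm [measurable]: "(\<lambda>(x, y). p x y) \<in> borel_measurable (M \<Otimes>\<^sub>M count_space UNIV)"
    by (rule joint_densityD(1)[OF p])
  interpret M: sigma_finite_measure M by (rule M)
  interpret PM: product_sigma_finite "\<lambda>_. M" by unfold_locales
  interpret J: prob_space "joint_distr M p" by (rule prob_space_joint_distr[OF p])
  interpret PJ: product_sigma_finite "\<lambda>_. joint_distr M p" by unfold_locales
  let ?C = "count_space (UNIV :: 'b set)"
  let ?f = "\<lambda>x y u v. f ((\<lambda>i\<in>I. (x i, y i))(k := (u, v)))"
  have pm' [measurable]: "(\<lambda>x. p x y) \<in> borel_measurable M" for y
    using measurable_compose[OF measurable_Pair2'[of y ?C M] pm] by simp
  have f': "f \<in> borel_measurable (\<Pi>\<^sub>M i\<in>insert k I. joint_distr M p)"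
    by measurable
  have sets_J: "sets (\<Pi>\<^sub>M i\<in>I. joint_distr M p) = sets (\<Pi>\<^sub>M i\<in>I. (M \<Otimes>\<^sub>M ?C))"
    by (intro sets_PiM_cong) auto
  have g: "(\<lambda>T. \<integral>\<^sup>+ z. f (T(k := z)) \<partial>joint_distr M p)
      \<in> borel_measurable (\<Pi>\<^sub>M i\<in>I. (M \<Otimes>\<^sub>M ?C))"
    by measurable
  have point: "(\<integral>\<^sup>+ z. f ((\<lambda>i\<in>I. (x i, y i))(k := z)) \<partial>joint_distr M p) =
      (\<integral>\<^sup>+ u. (\<Sum>v\<in>UNIV. ennreal (p u v) * ?f x y u v) \<partial>M)"
    and f_meas: "\<And>v. (\<lambda>u. ?f x y u v) \<in> borel_measurable M"
    if x: "x \<in> space (\<Pi>\<^sub>M i\<in>I. M)" for x and y :: "'i \<Rightarrow> 'b"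
  proof -
    have T: "(\<lambda>i\<in>I. (x i, y i)) \<in> space (\<Pi>\<^sub>M i\<in>I. (M \<Otimes>\<^sub>M ?C))"
      using x by (auto simp: space_PiM space_pair_measure PiE_iff)
    have m: "(\<lambda>z. f ((\<lambda>i\<in>I. (x i, y i))(k := z))) \<in> borel_measurable (M \<Otimes>\<^sub>M ?C)"
      using measurable_comp[OF measurable_component_update[OF T insert.hyps(2)] f]
      by (simp add: comp_def)
    show "(\<integral>\<^sup>+ z. f ((\<lambda>i\<in>I. (x i, y i))(k := z)) \<partial>joint_distr M p) =
        (\<integral>\<^sup>+ u. (\<Sum>v\<in>UNIV. ennreal (p u v) * ?f x y u v) \<partial>M)"
      by (rule nn_integral_joint_distr[OF p m])
    show "(\<lambda>u. ?f x y u v) \<in> borel_measurable M" for v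
      using measurable_compose[OF measurable_Pair2'[of v ?C M] m] by simp
  qed
  have step: "(\<Sum>y\<in>insert k I \<rightarrow>\<^sub>E UNIV. (\<Prod>i\<in>insert k I. ennreal (p ((x(k := u)) i) (y i))) *
        f (\<lambda>i\<in>insert k I. ((x(k := u)) i, y i))) =
      (\<Sum>y\<in>I \<rightarrow>\<^sub>E UNIV. (\<Prod>i\<in>I. ennreal (p (x i) (y i))) *
        (\<Sum>v\<in>UNIV. ennreal (p u v) * ?f x y u v))" for x u
  proof -
    have inj: "inj_on (\<lambda>(v, y). y(k := v)) (UNIV \<times> (I \<rightarrow>\<^sub>E (UNIV :: 'b set)))"
      using inj_combinator[OF insert.hyps(2), of "\<lambda>_. UNIV"] by simp
    have prod: "(\<Prod>i\<in>I. ennreal (p ((x(k := u)) i) ((y(k := v)) i))) =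
        (\<Prod>i\<in>I. ennreal (p (x i) (y i)))" for y :: "'i \<Rightarrow> 'b" and v
      using insert.hyps by (intro prod.cong) auto
    have upd: "(\<lambda>i\<in>insert k I. ((x(k := u)) i, (y(k := v)) i)) = (\<lambda>i\<in>I. (x i, y i))(k := (u, v))"
      for y :: "'i \<Rightarrow> 'b" and v
      using insert.hyps by (auto simp: fun_eq_iff)
    show ?thesis
      unfolding PiE_insert_eq sum.reindex[OF inj] o_def split_beta prod.insert[OF insert.hyps]
      unfolding fst_conv snd_conv upd prod
      by (subst sum.cartesian_product[symmetric, where g = "\<lambda>v y. _ v y", unfolded split_beta])
         (subst sum.swap, simp add: sum_distrib_left mult_ac)
  qed
  have fm: "(\<lambda>x. (\<Sum>y\<in>insert k I \<rightarrow>\<^sub>E UNIV. (\<Prod>i\<in>insert k I. ennreal (p (x i) (y i))) *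
      f (\<lambda>i\<in>insert k I. (x i, y i)))) \<in> borel_measurable (\<Pi>\<^sub>M i\<in>insert k I. M)"
    by measurable
  have "(\<integral>\<^sup>+ T. f T \<partial>(\<Pi>\<^sub>M i\<in>insert k I. joint_distr M p)) =
      (\<integral>\<^sup>+ T. (\<integral>\<^sup>+ z. f (T(k := z)) \<partial>joint_distr M p) \<partial>(\<Pi>\<^sub>M i\<in>I. joint_distr M p))"
    by (rule PJ.product_nn_integral_insert[OF insert.hyps f'])
  also have "\<dots> = (\<integral>\<^sup>+ x. (\<Sum>y\<in>I \<rightarrow>\<^sub>E UNIV. (\<Prod>i\<in>I. ennreal (p (x i) (y i))) *
      (\<integral>\<^sup>+ z. f ((\<lambda>i\<in>I. (x i, y i))(k := z)) \<partial>joint_distr M p)) \<partial>(\<Pi>\<^sub>M i\<in>I. M))"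
    by (rule insert.IH[OF g])
  also have "\<dots> = (\<integral>\<^sup>+ x. (\<integral>\<^sup>+ u. (\<Sum>y\<in>I \<rightarrow>\<^sub>E UNIV. (\<Prod>i\<in>I. ennreal (p (x i) (y i))) *
      (\<Sum>v\<in>UNIV. ennreal (p u v) * ?f x y u v)) \<partial>M) \<partial>(\<Pi>\<^sub>M i\<in>I. M))"
  proof (rule nn_integral_cong)
    fix x assume x: "x \<in> space (\<Pi>\<^sub>M i\<in>I. M)"
    note [measurable] = f_meas[OF x]
    show "(\<Sum>y\<in>I \<rightarrow>\<^sub>E UNIV. (\<Prod>i\<in>I. ennreal (p (x i) (y i))) *
        (\<integral>\<^sup>+ z. f ((\<lambda>i\<in>I. (x i, y i))(k := z)) \<partial>joint_distr M p)) =
      (\<integral>\<^sup>+ u. (\<Sum>y\<in>I \<rightarrow>\<^sub>E UNIV. (\<Prod>i\<in>I. ennreal (p (x i) (y i))) *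
        (\<Sum>v\<in>UNIV. ennreal (p u v) * ?f x y u v)) \<partial>M)"
      unfolding point[OF x]
      by (subst nn_integral_sum) (simp_all add: nn_integral_cmult)
  qed
  also have "\<dots> = (\<integral>\<^sup>+ x. (\<integral>\<^sup>+ u.
      (\<Sum>y\<in>insert k I \<rightarrow>\<^sub>E UNIV. (\<Prod>i\<in>insert k I. ennreal (p ((x(k := u)) i) (y i))) *
        f (\<lambda>i\<in>insert k I. ((x(k := u)) i, y i))) \<partial>M) \<partial>(\<Pi>\<^sub>M i\<in>I. M))"
    unfolding step ..
  also have "\<dots> = (\<integral>\<^sup>+ x. (\<Sum>y\<in>insert k I \<rightarrow>\<^sub>E UNIV.
      (\<Prod>i\<in>insert k I. ennreal (p (x i) (y i))) * f (\<lambda>i\<in>insert k I. (x i, y i)))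
      \<partial>(\<Pi>\<^sub>M i\<in>insert k I. M))"
    by (rule PM.product_nn_integral_insert[OF insert.hyps fm, symmetric])
  finally show ?case .
qed

lemma psi_sele_cong:
  "(\<And>i. i \<in> {1..n} \<Longrightarrow> T i = T' i) \<Longrightarrow> psi_sele n loss h s T = psi_sele n loss h s T'"
  unfolding psi_sele_def by (intro arg_cong2[where f = "(*)"] refl sum.cong) auto

text \<open>
  For a \<open>\<sigma>\<close>-finite reference measure, \<open>E_proxy\<close> is the integral over \<open>\<X>\<^sup>n\<close> of the sum over all
  label vectors, weighted by the product of the densities.
\<close>

lemma E_proxy_eq_integral:
  fixes p :: "'a \<Rightarrow> 'b::finite \<Rightarrow> real"
  assumes "sigma_finite_measure M" and "joint_density M p"
    and [measurable]: "h \<in> M \<rightarrow>\<^sub>M count_space UNIV" "s \<in> borel_measurable M"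
  shows "E_proxy M p loss h n s =
    (\<integral>\<^sup>+ x. (\<Sum>y\<in>{1..n} \<rightarrow>\<^sub>E UNIV. (\<Prod>i=1..n. ennreal (p (x i) (y i))) *
       ennreal (psi_sele n loss h s (\<lambda>i. (x i, y i)))) \<partial>(\<Pi>\<^sub>M i\<in>{1..n}. M))"
proof -
  have "(\<lambda>T. ennreal (psi_sele n loss h s T))
      \<in> borel_measurable (\<Pi>\<^sub>M i\<in>{1..n}. (M \<Otimes>\<^sub>M count_space (UNIV :: 'b set)))"
    unfolding psi_sele_def by measurable
  note nn_integral_PiM_joint_distr[OF assms(1,2) finite_atLeastAtMost this]
  moreover have "psi_sele n loss h s (\<lambda>i\<in>{1..n}. (x i, y i)) =
      psi_sele n loss h s (\<lambda>i. (x i, y i))" for x y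
    by (rule psi_sele_cong) simp
  ultimately show ?thesis
    unfolding E_proxy_def by simp
qed

end

theory Submission
  imports Defs
begin

text \<open>
  Up to a positive factor and a finite additive constant, the expected proxy is
  \<open>F(s) = \<integral>\<integral> r(x) \<phi>(s(z) - s(x)) dP(z) dP(x)\<close> with \<open>\<phi>(t) = ln (1 + exp t)\<close>, where \<open>P\<close> is the input
  distribution. Let \<open>\<sigma> = \<phi>'\<close>, \<open>A(x) = \<integral> r(z) \<sigma>(s(x) - s(z)) dP(z)\<close>,
  \<open>B(x) = \<integral> \<sigma>(s(z) - s(x)) dP(z)\<close> and \<open>G = A - r B\<close>; the derivative of \<open>F\<close> at \<open>s\<close> in a bounded
  direction \<open>g\<close> is \<open>\<integral> g G dP\<close>. Moving a minimizer \<open>s\<close> in the bounded direction \<open>- G\<close> therefore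
  yields \<open>G = 0\<close> almost surely, i.e. \<open>r = A / B\<close>. Since \<open>\<sigma>\<close> is increasing, \<open>A(x)\<close> is a
  nondecreasing and \<open>B(x)\<close> a nonincreasing positive function of \<open>s(x)\<close>, so \<open>s(x) \<ge> s(x')\<close> forces
  \<open>r(x) \<ge> r(x')\<close>.
\<close>

section \<open>Elementary bounds for the logistic loss and its derivative\<close>

definition softplus :: "real \<Rightarrow> real" where
  "softplus t = ln (1 + exp t)"

definition sigmoid :: "real \<Rightarrow> real" where
  "sigmoid t = exp t / (1 + exp t)"

lemma softplus_measurable [measurable]: "softplus \<in> borel_measurable borel"
  unfolding softplus_def by measurable

lemma sigmoid_measurable [measurable]: "sigmoid \<in> borel_measurable borel"
  unfolding sigmoid_def by measurable

lemma softplus_0: "softplus 0 = ln 2"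
  by (simp add: softplus_def)

lemma softplus_nonneg: "0 \<le> softplus t"
  by (simp add: softplus_def)

lemma sigmoid_pos: "0 < sigmoid t"
  by (simp add: sigmoid_def add_pos_pos)

lemma sigmoid_le_1: "sigmoid t \<le> 1"
  by (simp add: sigmoid_def divide_le_eq_1 add_pos_pos)

lemma sigmoid_mono: "t \<le> u \<Longrightarrow> sigmoid t \<le> sigmoid u"
  by (simp add: sigmoid_def divide_simps add_pos_pos add_nonneg_eq_0_iff) (simp add: algebra_simps)

text \<open>Inverting \<open>1 - d <= exp (- d)\<close> bounds \<open>exp d\<close> by
  \<open>1 / (1 - d)\<close>. The quadratic times \<open>1 - d\<close> exceeds 1 by
  \<open>d^2 * (1 - 2 * d)\<close>, which is where the threshold 1/2 comes from.\<close>

lemma exp_le_quadratic: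
  fixes d :: real
  assumes "d \<le> 1/2"
  shows "exp d \<le> 1 + d + 2 * d\<^sup>2"
proof -
  have "1 - d \<le> exp (- d)"
    using exp_ge_add_one_self[of "- d"] by simp
  then have "exp d * (1 - d) \<le> 1"
    by (metis exp_ge_zero exp_minus_inverse mult_left_mono)
  moreover have "1 \<le> (1 + d + 2 * d\<^sup>2) * (1 - d)"
  proof -
    have "(1 + d + 2 * d\<^sup>2) * (1 - d) = 1 + d\<^sup>2 * (1 - 2 * d)"
      by (simp add: power2_eq_square algebra_simps)
    then show ?thesis using assms by simp
  qed
  ultimately have "exp d * (1 - d) \<le> (1 + d + 2 * d\<^sup>2) * (1 - d)"
    by linarith
  then show ?thesis using assms by simp
qed

text \<open>The quotient of \<open>1 + exp (t + d)\<close> and \<open>1 + exp t\<close> is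
  \<open>1 + sigmoid t * (exp d - 1)\<close>, and \<open>ln\<close> lies below its tangent at 1. An
  upper estimate is enough, since it is applied to a competitor of the minimizer.\<close>

lemma softplus_add_le:
  assumes "d \<le> 1/2"
  shows "softplus (t + d) \<le> softplus t + sigmoid t * (d + 2 * d\<^sup>2)"
proof -
  have pos: "0 < 1 + exp t" by (simp add: add_pos_pos)
  have split: "1 + exp (t + d) = (1 + exp t) * (1 + sigmoid t * (exp d - 1))"
    using pos by (simp add: sigmoid_def exp_add field_simps)
  have "0 < 1 + exp (t + d)" by (simp add: add_pos_pos)
  then have pos': "0 < 1 + sigmoid t * (exp d - 1)"
    using pos unfolding split by (simp add: zero_less_mult_iff)
  have "softplus (t + d) = softplus t + ln (1 + sigmoid t * (exp d - 1))"
    unfolding softplus_def split by (rule ln_mult_pos[OF pos pos'])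
  also have "\<dots> \<le> softplus t + sigmoid t * (exp d - 1)"
    using ln_le_minus_one[OF pos'] by simp
  also have "\<dots> \<le> softplus t + sigmoid t * (d + 2 * d\<^sup>2)"
    using exp_le_quadratic[OF assms] sigmoid_pos[of t] by (simp add: mult_left_mono)
  finally show ?thesis .
qed

text \<open>This is the functional \<open>F\<close> of the overview. Its values lie in
  \<open>ennreal\<close>, as those of \<open>E_proxy\<close> do, so a score of infinite risk cannot
  pass for a minimizer.\<close>

definition pairwise_risk :: "'a measure \<Rightarrow> ('a \<Rightarrow> real) \<Rightarrow> ('a \<Rightarrow> real) \<Rightarrow> ennreal" where
  "pairwise_risk P r s =
     (\<integral>\<^sup>+ z. ennreal (r (fst z) * softplus (s (snd z) - s (fst z))) \<partial>(P \<Otimes>\<^sub>M P))"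

section \<open>Minimizers of the pairwise risk over a probability space\<close>

context prob_space
begin

text \<open>With \<open>D\<close> the integral of \<open>G^2\<close>, the competitor
  \<open>s - e * G\<close> has risk at most that of \<open>s\<close> minus \<open>e * D\<close> plus
  \<open>8 * C^3 * e^2\<close>. Minimality gives \<open>D <= 8 * C^3 * e\<close> for all small
  \<open>e > 0\<close>, hence \<open>D = 0\<close>.\<close>

lemma minimizer_stationary:
  fixes r s :: "'a \<Rightarrow> real"
  defines "G \<equiv> \<lambda>x. (\<integral>z. r z * sigmoid (s x - s z) \<partial>M) - r x * (\<integral>z. sigmoid (s z - s x) \<partial>M)"
  assumes [measurable]: "r \<in> borel_measurable M" "s \<in> borel_measurable M"
    and r0: "\<And>x. x \<in> space M \<Longrightarrow> 0 \<le> r x" and rC: "\<And>x. x \<in> space M \<Longrightarrow> r x \<le> C"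
    and opt: "\<And>s'. s' \<in> borel_measurable M \<Longrightarrow> pairwise_risk M r s \<le> pairwise_risk M r s'"
  shows "AE x in M. G x = 0"
proof -
  interpret PP: pair_prob_space M M ..
  let ?PP = "M \<Otimes>\<^sub>M M"
  define A where "A x = (\<integral>z. r z * sigmoid (s x - s z) \<partial>M)" for x
  define B where "B x = (\<integral>z. sigmoid (s z - s x) \<partial>M)" for x
  have G: "G x = A x - r x * B x" for x by (simp add: G_def A_def B_def)
  have [measurable]: "A \<in> borel_measurable M" "B \<in> borel_measurable M"
    unfolding A_def B_def by measurable
  have [measurable]: "G \<in> borel_measurable M"
    unfolding G by measurable
  \<comment> \<open>A probability space is nonempty, so \<open>C\<close> inherits nonnegativity from
    \<open>r\<close>.\<close>
  obtain x0 where "x0 \<in> space M" using not_empty by blast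
  then have C0: "0 \<le> C" using r0[of x0] rC[of x0] by linarith
  have rs: "0 \<le> r x * sigmoid t" "r x * sigmoid t \<le> C" if "x \<in> space M" for x t
    using r0[OF that] rC[OF that] sigmoid_pos[of t] sigmoid_le_1[of t]
      mult_mono[of "r x" C "sigmoid t" 1] C0 by auto
  have A01: "0 \<le> A x" "A x \<le> C" for x
  proof -
    have int: "integrable M (\<lambda>z. r z * sigmoid (s x - s z))"
      by (rule integrable_const_bound[where B = C]) (auto simp: rs intro!: AE_I2)
    show "0 \<le> A x" unfolding A_def by (intro Bochner_Integration.integral_nonneg rs) auto
    show "A x \<le> C" unfolding A_def using rs by (intro integral_le_const[OF int] AE_I2) auto
  qed
  have B01: "0 \<le> B x" "B x \<le> 1" for x
  proof -
    have int: "integrable M (\<lambda>z. sigmoid (s z - s x))"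
      by (rule integrable_const_bound[where B = 1])
        (auto simp: sigmoid_le_1 abs_of_pos[OF sigmoid_pos] intro!: AE_I2)
    show "0 \<le> B x" unfolding B_def
      by (intro Bochner_Integration.integral_nonneg less_imp_le sigmoid_pos)
    show "B x \<le> 1" unfolding B_def
      by (intro integral_le_const[OF int] AE_I2 sigmoid_le_1)
  qed
  have rB: "0 \<le> r x * B x" "r x * B x \<le> C" if "x \<in> space M" for x
    using r0[OF that] rC[OF that] B01[of x] mult_mono[of "r x" C "B x" 1] C0 by auto
  have GC: "\<bar>G x\<bar> \<le> C" if "x \<in> space M" for x
    using A01[of x] rB[OF that] by (simp add: G)
  define f where "f z = r (fst z) * softplus (s (snd z) - s (fst z))" for z
  \<comment> \<open>\<open>k\<close> is the derivative of the integrand \<open>f\<close> in the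
    direction \<open>- G\<close>: the score difference \<open>s y - s x\<close> then changes at rate
    \<open>G x - G y\<close>.\<close>
  define k where "k z = r (fst z) * sigmoid (s (snd z) - s (fst z)) * (G (fst z) - G (snd z))" for z
  define D where "D = (\<integral>x. (G x)\<^sup>2 \<partial>M)"
  have [measurable]: "f \<in> borel_measurable ?PP" "k \<in> borel_measurable ?PP"
    unfolding f_def k_def by measurable
  \<comment> \<open>The constant score 0 has finite risk because \<open>r\<close> is bounded, so the
    minimizer does too. This permits passing to Bochner integrals and subtracting.\<close>
  have fin: "pairwise_risk M r s < \<infinity>"
  proof -
    have "pairwise_risk M r s \<le> pairwise_risk M r (\<lambda>_. 0)" by (rule opt) simp
    also have "\<dots> \<le> (\<integral>\<^sup>+ z. ennreal (C * ln 2) \<partial>?PP)"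
      unfolding pairwise_risk_def
      by (intro nn_integral_mono ennreal_leI)
        (auto simp: softplus_0 space_pair_measure rC intro!: mult_right_mono)
    also have "\<dots> < \<infinity>" by (simp add: PP.emeasure_space_1 ennreal_mult_less_top)
    finally show ?thesis .
  qed
  have f0: "0 \<le> f z" if "z \<in> space ?PP" for z
    using that by (auto simp: f_def space_pair_measure softplus_nonneg r0)
  have int_f: "integrable ?PP f"
    using fin f0
    by (intro integrableI_nonneg) (auto simp: pairwise_risk_def f_def intro!: AE_I2)
  have int_rs: "integrable ?PP (\<lambda>z. r (fst z) * sigmoid (s (snd z) - s (fst z)) * g z)"
    if [measurable]: "g \<in> borel_measurable ?PP" and g: "\<And>z. z \<in> space ?PP \<Longrightarrow> \<bar>g z\<bar> \<le> C" for g
  proof (rule PP.integrable_const_bound[where B = "C * C"])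
    show "AE z in ?PP. norm (r (fst z) * sigmoid (s (snd z) - s (fst z)) * g z) \<le> C * C"
      using rs g C0
      by (intro AE_I2)
        (auto simp: abs_mult space_pair_measure r0 abs_of_pos[OF sigmoid_pos] intro!: mult_mono)
  qed measurable
  have int_G1: "integrable ?PP (\<lambda>z. r (fst z) * sigmoid (s (snd z) - s (fst z)) * G (fst z))"
    by (rule int_rs) (auto simp: GC space_pair_measure)
  have int_G2: "integrable ?PP (\<lambda>z. r (fst z) * sigmoid (s (snd z) - s (fst z)) * G (snd z))"
    by (rule int_rs) (auto simp: GC space_pair_measure)
  have int_k: "integrable ?PP k"
    using Bochner_Integration.integrable_diff[OF int_G1 int_G2]
    by (simp add: k_def[abs_def] right_diff_distrib)
  have G2: "(\<lambda>x. (G x)\<^sup>2) \<in> borel_measurable M" "\<And>x. x \<in> space M \<Longrightarrow> (G x)\<^sup>2 \<le> C\<^sup>2"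
    using GC C0 by (auto simp: abs_le_square_iff[symmetric])
  have int_GG: "integrable M (\<lambda>x. (G x)\<^sup>2)"
    by (rule integrable_const_bound[where B = "C\<^sup>2"]) (auto simp: G2)
  have int_GA: "integrable M (\<lambda>x. G x * A x)"
    by (rule integrable_const_bound[where B = "C * C"])
      (auto simp: abs_mult A01 C0 GC intro!: mult_mono AE_I2)
  have int_GB: "integrable M (\<lambda>x. G x * (r x * B x))"
    by (rule integrable_const_bound[where B = "C * C"])
      (auto simp: abs_mult[of "G _"] abs_of_nonneg rB C0 GC intro!: mult_mono AE_I2)
  \<comment> \<open>Each half of \<open>k\<close> has \<open>G\<close> in one variable only, and the
    other variable is integrated out by Fubini. This leaves \<open>G * (r * B)\<close> and
    \<open>G * A\<close>, whose difference is \<open>- G^2\<close>.\<close>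
  have int_k_eq: "integral\<^sup>L ?PP k = - D"
  proof -
    have "integral\<^sup>L ?PP k =
        (\<integral>z. r (fst z) * sigmoid (s (snd z) - s (fst z)) * G (fst z) \<partial>?PP) -
        (\<integral>z. r (fst z) * sigmoid (s (snd z) - s (fst z)) * G (snd z) \<partial>?PP)"
      unfolding Bochner_Integration.integral_diff[OF int_G1 int_G2, symmetric]
      by (simp add: k_def[abs_def] right_diff_distrib)
    also have "(\<integral>z. r (fst z) * sigmoid (s (snd z) - s (fst z)) * G (fst z) \<partial>?PP) =
        (\<integral>x. \<integral>z. r x * sigmoid (s z - s x) * G x \<partial>M \<partial>M)"
      using PP.integral_fst'[OF int_G1] by simp
    also have "\<dots> = (\<integral>x. G x * (r x * B x) \<partial>M)"
      by (simp add: B_def mult_ac)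
    also have "(\<integral>z. r (fst z) * sigmoid (s (snd z) - s (fst z)) * G (snd z) \<partial>?PP) =
        (\<integral>x. \<integral>z. r z * sigmoid (s x - s z) * G x \<partial>M \<partial>M)"
      using PP.integral_snd[of "\<lambda>x z. r x * sigmoid (s z - s x) * G z"] int_G2
      by (simp add: split_beta')
    also have "\<dots> = (\<integral>x. G x * A x \<partial>M)"
      by (simp add: A_def mult_ac)
    also have "(\<integral>x. G x * (r x * B x) \<partial>M) - (\<integral>x. G x * A x \<partial>M) =
        (\<integral>x. - (G x)\<^sup>2 \<partial>M)"
      unfolding Bochner_Integration.integral_diff[OF int_GB int_GA, symmetric]
      by (simp add: G power2_eq_square algebra_simps)
    also have "\<dots> = - D" by (simp add: D_def)
    finally show ?thesis .
  qed
  \<comment> \<open>The condition \<open>4 * C * e <= 1\<close> keeps the perturbation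
    \<open>d\<close> of a score difference, of size at most \<open>2 * C * e\<close>, within the
    range of \<open>softplus_add_le\<close>. The constant is \<open>C * 2 * (2 * C)^2\<close>, from
    \<open>r * sigmoid <= C\<close> and the bound on \<open>d\<close>.\<close>
  have step: "D \<le> 8 * C ^ 3 * e" if e: "0 < e" "4 * C * e \<le> 1" for e
  proof -
    define s' where "s' x = s x - e * G x" for x
    have [measurable]: "s' \<in> borel_measurable M" unfolding s'_def by measurable
    define f' where "f' z = r (fst z) * softplus (s' (snd z) - s' (fst z))" for z
    define u where "u z = f z + e * k z + 8 * C ^ 3 * e\<^sup>2" for z
    have int_u: "integrable ?PP u"
      unfolding u_def[abs_def] using int_f int_k by simp
    have f'u: "f' z \<le> u z" if z: "z \<in> space ?PP" for z
    proof -
      obtain x y where xy: "z = (x, y)" "x \<in> space M" "y \<in> space M"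
        using z by (auto simp: space_pair_measure)
      define d where "d = e * (G x - G y)"
      have "\<bar>G x - G y\<bar> \<le> 2 * C" using GC[OF xy(2)] GC[OF xy(3)] by linarith
      then have d: "\<bar>d\<bar> \<le> e * (2 * C)" unfolding d_def using e by (simp add: abs_mult)
      then have "d \<le> 1/2" using e by (simp add: mult_ac)
      have "d\<^sup>2 \<le> (e * (2 * C))\<^sup>2"
        using d by (metis abs_ge_zero power2_abs power_mono)
      then have "r x * sigmoid (s y - s x) * (2 * d\<^sup>2) \<le> C * (2 * (e * (2 * C))\<^sup>2)"
        using rs[OF xy(2)] C0 by (intro mult_mono) auto
      then have quad: "r x * sigmoid (s y - s x) * (2 * d\<^sup>2) \<le> 8 * C ^ 3 * e\<^sup>2"
        by (simp add: power2_eq_square power3_eq_cube mult_ac)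
      have "f' z = r x * softplus ((s y - s x) + d)"
        by (simp add: f'_def s'_def d_def xy algebra_simps)
      also have "\<dots> \<le> r x * (softplus (s y - s x) + sigmoid (s y - s x) * (d + 2 * d\<^sup>2))"
        by (intro mult_left_mono softplus_add_le \<open>d \<le> 1/2\<close> r0 xy)
      also have "\<dots> = f z + e * k z + r x * sigmoid (s y - s x) * (2 * d\<^sup>2)"
        by (simp add: f_def k_def d_def xy algebra_simps)
      also have "\<dots> \<le> u z"
        unfolding u_def by (intro add_left_mono quad)
      finally show ?thesis .
    qed
    \<comment> \<open>The term \<open>k\<close> changes sign, so nonnegativity of the majorant
      \<open>u\<close> is read off from \<open>f' <= u\<close>.\<close>
    have u0: "0 \<le> u z" if "z \<in> space ?PP" for z
    proof -
      have "0 \<le> f' z"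
        using that by (auto simp: f'_def space_pair_measure softplus_nonneg r0)
      then show ?thesis using f'u[OF that] by linarith
    qed
    have "ennreal (integral\<^sup>L ?PP f) = pairwise_risk M r s"
      unfolding pairwise_risk_def f_def[symmetric]
      by (rule nn_integral_eq_integral[OF int_f, symmetric]) (auto simp: f0)
    also have "\<dots> \<le> pairwise_risk M r s'" by (rule opt) simp
    also have "\<dots> \<le> (\<integral>\<^sup>+ z. ennreal (u z) \<partial>?PP)"
      unfolding pairwise_risk_def f'_def[symmetric]
      by (intro nn_integral_mono ennreal_leI f'u)
    also have "\<dots> = ennreal (integral\<^sup>L ?PP u)"
      by (rule nn_integral_eq_integral[OF int_u]) (auto simp: u0)
    finally have "integral\<^sup>L ?PP f \<le> integral\<^sup>L ?PP u"
      by (subst (asm) ennreal_le_iff) (auto intro!: Bochner_Integration.integral_nonneg u0)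
    also have "integral\<^sup>L ?PP u = integral\<^sup>L ?PP f + e * (- D) + 8 * C ^ 3 * e\<^sup>2"
      unfolding u_def[abs_def] int_k_eq[symmetric] using int_f int_k
      by (simp add: PP.prob_space)
    finally have "e * D \<le> e * (8 * C ^ 3 * e)" by (simp add: power2_eq_square mult_ac)
    then show ?thesis using e by simp
  qed
  have "D \<le> 0"
  proof (rule tendsto_lowerbound)
    show "((\<lambda>e. 8 * C ^ 3 * e) \<longlongrightarrow> 0) (at_right 0)"
      by (auto intro!: tendsto_eq_intros)
    \<comment> \<open>Adding 1 to the denominator keeps the interval nonempty when
      \<open>C = 0\<close>.\<close>
    have "eventually (\<lambda>e. e \<in> {0<..<1 / (4 * C + 1)}) (at_right (0 :: real))"
      using C0 by (intro eventually_at_right_real) simp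
    then show "\<forall>\<^sub>F e in at_right 0. D \<le> 8 * C ^ 3 * e"
    proof eventually_elim
      case (elim e)
      then have "(4 * C + 1) * e \<le> 1" using C0 by (simp add: field_simps)
      then show ?case using elim by (intro step) (auto simp: algebra_simps)
    qed
  qed simp
  moreover have "0 \<le> D" unfolding D_def by simp
  ultimately have "(\<integral>x. (G x)\<^sup>2 \<partial>M) = 0" unfolding D_def by simp
  then show ?thesis
    using integral_nonneg_eq_0_iff_AE[OF int_GG] by simp
qed

lemma minimizer_ranks:
  fixes r s :: "'a \<Rightarrow> real"
  assumes [measurable]: "r \<in> borel_measurable M" "s \<in> borel_measurable M"
    and r0: "\<And>x. x \<in> space M \<Longrightarrow> 0 \<le> r x" and rC: "\<And>x. x \<in> space M \<Longrightarrow> r x \<le> C"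
    and opt: "\<And>s'. s' \<in> borel_measurable M \<Longrightarrow> pairwise_risk M r s \<le> pairwise_risk M r s'"
  shows "AE (x, x') in M \<Otimes>\<^sub>M M. r x < r x' \<longrightarrow> s x < s x'"
proof -
  interpret PP: pair_prob_space M M ..
  define A where "A x = (\<integral>z. r z * sigmoid (s x - s z) \<partial>M)" for x
  define B where "B x = (\<integral>z. sigmoid (s z - s x) \<partial>M)" for x
  have A_int: "integrable M (\<lambda>z. r z * sigmoid (s x - s z))" for x
  proof (rule integrable_const_bound[where B = "C * 1"])
    show "AE z in M. norm (r z * sigmoid (s x - s z)) \<le> C * 1"
      unfolding real_norm_def abs_mult
      by (intro AE_I2 mult_mono)
        (auto simp: r0 rC sigmoid_le_1 abs_of_pos[OF sigmoid_pos] less_imp_le[OF sigmoid_pos]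
          intro: order_trans[OF r0 rC])
  qed measurable
  have B_int: "integrable M (\<lambda>z. sigmoid (s z - s x))" for x
    by (rule integrable_const_bound[where B = 1])
      (auto simp: sigmoid_le_1 abs_of_pos[OF sigmoid_pos] intro!: AE_I2)
  have A_mono: "A x \<le> A x'" if "s x \<le> s x'" for x x'
    unfolding A_def using that
    by (intro integral_mono A_int mult_left_mono sigmoid_mono r0) (auto simp: less_imp_le[OF sigmoid_pos])
  have B_anti: "B x' \<le> B x" if "s x \<le> s x'" for x x'
    unfolding B_def using that
    by (intro integral_mono B_int sigmoid_mono) auto
  \<comment> \<open>Strictness matters here: it lets \<open>r x < r x'\<close> survive
    multiplication by \<open>B x\<close>.\<close>
  have B_pos: "0 < B x" for x
    unfolding B_def
    by (rule expectation_greater[OF B_int]) (simp add: sigmoid_pos)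
  have ord: "s x < s x'"
    if "A x - r x * B x = 0" "A x' - r x' * B x' = 0" "r x < r x'" "x \<in> space M" "x' \<in> space M"
    for x x'
  proof (rule ccontr)
    assume "\<not> s x < s x'"
    then have le: "s x' \<le> s x" by simp
    have "r x * B x < r x' * B x" using that B_pos by simp
    also have "\<dots> \<le> r x' * B x'"
      using B_anti[OF le] that by (intro mult_left_mono r0)
    also have "\<dots> \<le> A x" using A_mono[OF le] that by simp
    finally show False using that by simp
  qed
  have stat: "AE x in M. A x - r x * B x = 0"
    unfolding A_def B_def by (rule minimizer_stationary[OF assms])
  show ?thesis
  \<comment> \<open>\<open>ord\<close> is a pointwise implication between stationary points, so
    applying \<open>stat\<close> once in each variable suffices.\<close>
  proof (rule PP.AE_pair_measure)
    show "AE x in M. AE y in M. case (x, y) of (x, x') \<Rightarrow> r x < r x' \<longrightarrow> s x < s x'"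
      using stat AE_space
    proof eventually_elim
      case (elim x)
      show ?case using stat AE_space by eventually_elim (use elim ord in auto)
    qed
  qed measurable
qed

end

section \<open>From the joint distribution to the input distribution\<close>

lemma sets_input_distr [measurable_cong, simp]: "sets (input_distr M p) = sets M"
  by (simp add: input_distr_def)

lemma space_input_distr [simp]: "space (input_distr M p) = space M"
  by (simp add: input_distr_def)

context
  fixes M :: "'a measure" and p :: "'a \<Rightarrow> 'b::finite \<Rightarrow> real"
  assumes p: "joint_density M p"
begin

lemma density_measurable [measurable]: "(\<lambda>x. p x y) \<in> borel_measurable M"
  using measurable_compose[OF measurable_Pair2'[of y "count_space UNIV" M] joint_densityD(1)[OF p]]
  by simp

lemma marginal_measurable [measurable]: "marginal p \<in> borel_measurable M"
  unfolding marginal_def[abs_def] by measurable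

lemma cond_prob_label_bounds:
  assumes "x \<in> space M"
  shows "0 \<le> cond_prob_label p x y" "cond_prob_label p x y \<le> 1"
proof -
  have "0 \<le> p x y" "p x y \<le> marginal p x"
    using joint_densityD(2)[OF p assms] by (auto simp: marginal_def intro!: member_le_sum)
  then show "0 \<le> cond_prob_label p x y" "cond_prob_label p x y \<le> 1"
    by (auto simp: cond_prob_label_def divide_le_eq_1)
qed

text \<open>Summing the joint density over the labels gives the marginal density. Taking
  \<open>g = 1\<close> transfers the total mass 1 to the input distribution.\<close>

lemma nn_integral_joint_distr_fst:
  assumes [measurable]: "g \<in> borel_measurable M"
  shows "(\<integral>\<^sup>+ z. g (fst z) \<partial>joint_distr M p) = (\<integral>\<^sup>+ x. g x \<partial>input_distr M p)"
proof -
  have "(\<integral>\<^sup>+ z. g (fst z) \<partial>joint_distr M p) = (\<integral>\<^sup>+ x. (\<Sum>y\<in>UNIV. ennreal (p x y) * g x) \<partial>M)"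
    by (subst nn_integral_joint_distr[OF p]) simp_all
  also have "\<dots> = (\<integral>\<^sup>+ x. ennreal (marginal p x) * g x \<partial>M)"
    by (intro nn_integral_cong)
      (simp add: marginal_def sum_distrib_right[symmetric] sum_ennreal joint_densityD(2)[OF p])
  also have "\<dots> = (\<integral>\<^sup>+ x. g x \<partial>input_distr M p)"
    unfolding input_distr_def by (subst nn_integral_density) simp_all
  finally show ?thesis .
qed

lemma prob_space_input_distr: "prob_space (input_distr M p)"
proof
  have "emeasure (input_distr M p) (space (input_distr M p)) = (\<integral>\<^sup>+ x. 1 \<partial>input_distr M p)"
    by simp
  also have "\<dots> = (\<integral>\<^sup>+ z. 1 \<partial>joint_distr M p)"
    by (rule nn_integral_joint_distr_fst[symmetric]) simp
  also have "\<dots> = 1"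
    using prob_space.emeasure_space_1[OF prob_space_joint_distr[OF p]] by simp
  finally show "emeasure (input_distr M p) (space (input_distr M p)) = 1" .
qed

section \<open>Conditional risk and the expected proxy\<close>

context
  fixes loss :: "'b \<Rightarrow> 'b \<Rightarrow> real" and h :: "'a \<Rightarrow> 'b"
  assumes loss: "\<And>y y'. 0 \<le> loss y y'"
    and h [measurable]: "h \<in> M \<rightarrow>\<^sub>M count_space UNIV"
begin

lemma cond_risk_measurable [measurable]: "cond_risk p loss h \<in> borel_measurable M"
  unfolding cond_risk_def[abs_def] cond_prob_label_def by measurable

lemma cond_risk_nonneg: "x \<in> space M \<Longrightarrow> 0 \<le> cond_risk p loss h x"
  unfolding cond_risk_def by (intro sum_nonneg mult_nonneg_nonneg cond_prob_label_bounds loss)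

text \<open>Finiteness of the label type yields a crude bound uniform in \<open>x\<close>, which
  serves as the constant \<open>C\<close> of \<open>minimizer_ranks\<close>.\<close>

lemma cond_risk_le:
  assumes "x \<in> space M"
  shows "cond_risk p loss h x \<le> (\<Sum>y\<in>UNIV. \<Sum>y'\<in>UNIV. loss y y')"
  unfolding cond_risk_def
proof (rule sum_mono)
  fix y
  have "cond_prob_label p x y * loss y (h x) \<le> 1 * loss y (h x)"
    by (intro mult_right_mono cond_prob_label_bounds assms loss)
  also have "\<dots> \<le> (\<Sum>y'\<in>UNIV. loss y y')"
    using loss by (auto intro!: member_le_sum)
  finally show "cond_prob_label p x y * loss y (h x) \<le> (\<Sum>y'\<in>UNIV. loss y y')" .
qed

text \<open>Conditioning on the input averages the loss to the conditional risk. The factorization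
  \<open>p x y = marginal p x * cond_prob_label p x y\<close> holds also where the marginal
  vanishes, so no inputs are excluded.\<close>

lemma nn_integral_joint_distr_loss:
  assumes [measurable]: "g \<in> borel_measurable M"
  shows "(\<integral>\<^sup>+ z. ennreal (loss (snd z) (h (fst z))) * g (fst z) \<partial>joint_distr M p) =
    (\<integral>\<^sup>+ x. ennreal (cond_risk p loss h x) * g x \<partial>input_distr M p)"
proof -
  have "(\<integral>\<^sup>+ z. ennreal (loss (snd z) (h (fst z))) * g (fst z) \<partial>joint_distr M p) =
      (\<integral>\<^sup>+ x. (\<Sum>y\<in>UNIV. ennreal (p x y) * (ennreal (loss y (h x)) * g x)) \<partial>M)"
    by (subst nn_integral_joint_distr[OF p]) simp_all
  also have "\<dots> = (\<integral>\<^sup>+ x. ennreal (marginal p x) * (ennreal (cond_risk p loss h x) * g x) \<partial>M)"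
  proof (rule nn_integral_cong)
    fix x assume x: "x \<in> space M"
    have marg: "0 \<le> marginal p x"
      unfolding marginal_def by (intro sum_nonneg joint_densityD(2)[OF p x])
    have "(\<Sum>y\<in>UNIV. ennreal (p x y) * (ennreal (loss y (h x)) * g x)) =
        ennreal (\<Sum>y\<in>UNIV. p x y * loss y (h x)) * g x"
      by (simp add: sum_distrib_right sum_ennreal[symmetric] loss joint_densityD(2)[OF p x]
        ennreal_mult mult.assoc)
    also have "(\<Sum>y\<in>UNIV. p x y * loss y (h x)) = marginal p x * cond_risk p loss h x"
      using marginal_times_cond[OF p x] by (simp add: cond_risk_def sum_distrib_left mult.assoc)
    finally show "(\<Sum>y\<in>UNIV. ennreal (p x y) * (ennreal (loss y (h x)) * g x)) =
        ennreal (marginal p x) * (ennreal (cond_risk p loss h x) * g x)"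
      by (simp add: ennreal_mult marg cond_risk_nonneg[OF x] mult.assoc)
  qed
  also have "\<dots> = (\<integral>\<^sup>+ x. ennreal (cond_risk p loss h x) * g x \<partial>input_distr M p)"
    unfolding input_distr_def by (subst nn_integral_density) simp_all
  finally show ?thesis .
qed

text \<open>Two distinct examples are independent. The second enters only through its input, so its
  label sums out; the label of the first is then averaged into the conditional risk.\<close>

lemma nn_integral_proxy_off_diagonal:
  assumes s [measurable]: "s \<in> borel_measurable M"
    and ij: "finite I" "i \<in> I" "j \<in> I" "i \<noteq> j"
  shows "(\<integral>\<^sup>+ T. ennreal (loss (snd (T i)) (h (fst (T i))) *
      softplus (s (fst (T j)) - s (fst (T i)))) \<partial>(\<Pi>\<^sub>M i\<in>I. joint_distr M p)) =
    pairwise_risk (input_distr M p) (cond_risk p loss h) s"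
proof -
  let ?J = "joint_distr M p" and ?P = "input_distr M p"
  interpret J: prob_space ?J by (rule prob_space_joint_distr[OF p])
  interpret P: prob_space ?P by (rule prob_space_input_distr)
  interpret PJ: product_prob_space "\<lambda>_. ?J" I by unfold_locales
  define k where "k a b = ennreal (loss (snd a) (h (fst a)) * softplus (s (fst b) - s (fst a)))"
    for a b :: "'a \<times> 'b"
  have k [measurable]: "case_prod k \<in> borel_measurable (?J \<Otimes>\<^sub>M ?J)"
    unfolding k_def by measurable
  have kij [measurable]: "(\<lambda>T. k (T i) (T j)) \<in> borel_measurable (\<Pi>\<^sub>M i\<in>{i, j}. ?J)"
    by measurable
  \<comment> \<open>Writing the integrand through \<open>restrict T {i, j}\<close> allows the
    marginal on these two coordinates to replace the full product.\<close>
  have "(\<integral>\<^sup>+ T. k (T i) (T j) \<partial>(\<Pi>\<^sub>M i\<in>I. ?J)) =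
      (\<integral>\<^sup>+ T. k (restrict T {i, j} i) (restrict T {i, j} j) \<partial>(\<Pi>\<^sub>M i\<in>I. ?J))"
    by simp
  also have "\<dots> = (\<integral>\<^sup>+ T. k (T i) (T j) \<partial>distr (\<Pi>\<^sub>M i\<in>I. ?J) (\<Pi>\<^sub>M i\<in>{i, j}. ?J) (\<lambda>T. restrict T {i, j}))"
    using ij by (intro nn_integral_distr[symmetric] kij measurable_restrict_subset) auto
  also have "\<dots> = (\<integral>\<^sup>+ T. k (T i) (T j) \<partial>(\<Pi>\<^sub>M i\<in>{i, j}. ?J))"
    using ij by (subst PJ.distr_restrict[symmetric]) auto
  also have "\<dots> = (\<integral>\<^sup>+ z. k (fst z) (snd z) \<partial>(?J \<Otimes>\<^sub>M ?J))"
    by (rule PJ.product_nn_integral_pair[OF k ij(4)])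
  also have "\<dots> = (\<integral>\<^sup>+ a. \<integral>\<^sup>+ b. k a b \<partial>?J \<partial>?J)"
    by (subst J.nn_integral_fst[symmetric]) (use k in \<open>simp_all add: split_beta'\<close>)
  also have "\<dots> = (\<integral>\<^sup>+ a. ennreal (loss (snd a) (h (fst a))) *
      (\<integral>\<^sup>+ z. ennreal (softplus (s z - s (fst a))) \<partial>?P) \<partial>?J)"
    by (simp add: k_def ennreal_mult loss softplus_nonneg nn_integral_cmult
      nn_integral_joint_distr_fst[symmetric])
  also have "\<dots> = (\<integral>\<^sup>+ x. ennreal (cond_risk p loss h x) *
      (\<integral>\<^sup>+ z. ennreal (softplus (s z - s x)) \<partial>?P) \<partial>?P)"
    by (rule nn_integral_joint_distr_loss) measurable
  also have "\<dots> = (\<integral>\<^sup>+ x. \<integral>\<^sup>+ z. ennreal (cond_risk p loss h x * softplus (s z - s x)) \<partial>?P \<partial>?P)"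
    by (intro nn_integral_cong)
      (simp add: ennreal_mult softplus_nonneg cond_risk_nonneg nn_integral_cmult)
  also have "\<dots> = pairwise_risk ?P (cond_risk p loss h) s"
    unfolding pairwise_risk_def by (subst P.nn_integral_fst[symmetric]) simp_all
  finally show ?thesis unfolding k_def .
qed

text \<open>An example compared with itself contributes \<open>softplus 0 = ln 2\<close> times its
  loss, whatever \<open>s\<close> is: this is the additive constant of the expected proxy.\<close>

lemma nn_integral_proxy_diagonal:
  assumes "finite I" "i \<in> I"
  shows "(\<integral>\<^sup>+ T. ennreal (loss (snd (T i)) (h (fst (T i))) *
      softplus (s (fst (T i)) - s (fst (T i)))) \<partial>(\<Pi>\<^sub>M i\<in>I. joint_distr M p)) =
    (\<integral>\<^sup>+ x. ennreal (cond_risk p loss h x) * ennreal (ln 2) \<partial>input_distr M p)"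
proof -
  let ?J = "joint_distr M p"
  interpret J: prob_space ?J by (rule prob_space_joint_distr[OF p])
  interpret PJ: product_prob_space "\<lambda>_. ?J" I by unfold_locales
  have "(\<integral>\<^sup>+ T. ennreal (loss (snd (T i)) (h (fst (T i)))) * ennreal (ln 2) \<partial>(\<Pi>\<^sub>M i\<in>I. ?J)) =
      (\<integral>\<^sup>+ a. ennreal (loss (snd a) (h (fst a))) * ennreal (ln 2)
        \<partial>distr (\<Pi>\<^sub>M i\<in>I. ?J) ?J (\<lambda>T. T i))"
    using assms by (subst nn_integral_distr) simp_all
  also have "\<dots> = (\<integral>\<^sup>+ x. ennreal (cond_risk p loss h x) * ennreal (ln 2) \<partial>input_distr M p)"
    unfolding PJ.PiM_component[OF assms(2)] by (rule nn_integral_joint_distr_loss) simp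
  finally show ?thesis by (simp add: softplus_0 ennreal_mult loss)
qed

text \<open>By linearity the double sum splits into \<open>n * (n - 1)\<close> off-diagonal and
  \<open>n\<close> diagonal terms, each group with a common expectation. For \<open>n = 0\<close>
  both sides are 0 by division by zero.\<close>

lemma E_proxy_eq_pairwise_risk:
  assumes s [measurable]: "s \<in> borel_measurable M"
  shows "E_proxy M p loss h n s = ennreal (1 / (real n)\<^sup>2) *
    (of_nat (n * (n - 1)) * pairwise_risk (input_distr M p) (cond_risk p loss h) s +
     of_nat n * (\<integral>\<^sup>+ x. ennreal (cond_risk p loss h x) * ennreal (ln 2) \<partial>input_distr M p))"
    (is "_ = _ * (_ * ?F + _ * ?R)")
proof -
  let ?J = "joint_distr M p"
  let ?PJ = "\<Pi>\<^sub>M i\<in>{1..n}. ?J"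
  define t where "t i j T = loss (snd (T i)) (h (fst (T i))) * softplus (s (fst (T j)) - s (fst (T i)))"
    for i j :: nat and T :: "nat \<Rightarrow> 'a \<times> 'b"
  have t0: "0 \<le> t i j T" for i j T by (simp add: t_def loss softplus_nonneg)
  have [measurable]: "t i j \<in> borel_measurable ?PJ" if "i \<in> {1..n}" "j \<in> {1..n}" for i j
    unfolding t_def using that by measurable
  have t_int: "(\<integral>\<^sup>+ T. ennreal (t i j T) \<partial>?PJ) = (if i = j then ?R else ?F)"
    if "i \<in> {1..n}" "j \<in> {1..n}" for i j
    using that nn_integral_proxy_off_diagonal[OF s _ that] nn_integral_proxy_diagonal[OF _ that(1)]
    by (auto simp: t_def)
  have "E_proxy M p loss h n s =
      (\<integral>\<^sup>+ T. ennreal (1 / (real n)\<^sup>2) * (\<Sum>i=1..n. \<Sum>j=1..n. ennreal (t i j T)) \<partial>?PJ)"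
    unfolding E_proxy_def psi_sele_def softplus_def[symmetric] t_def[symmetric]
    by (simp add: ennreal_mult[symmetric] sum_nonneg t0 sum_ennreal)
  also have "\<dots> = ennreal (1 / (real n)\<^sup>2) * (\<Sum>i=1..n. \<Sum>j=1..n. (\<integral>\<^sup>+ T. ennreal (t i j T) \<partial>?PJ))"
    by (subst nn_integral_cmult, measurable, subst nn_integral_sum, measurable)
      (intro arg_cong2[where f = "(*)"] refl sum.cong nn_integral_sum, measurable)
  also have "(\<Sum>i=1..n. \<Sum>j=1..n. (\<integral>\<^sup>+ T. ennreal (t i j T) \<partial>?PJ)) =
      (\<Sum>i=1..n. of_nat (n - 1) * ?F + ?R)"
  proof (rule sum.cong[OF refl])
    fix i assume i: "i \<in> {1..n}"
    have "(\<Sum>j=1..n. (\<integral>\<^sup>+ T. ennreal (t i j T) \<partial>?PJ)) = (\<Sum>j=1..n. if i = j then ?R else ?F)"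
      using i by (intro sum.cong refl t_int)
    also have "\<dots> = ?R + (\<Sum>j\<in>{1..n} - {i}. ?F)"
      using i by (subst sum.remove[of _ i]) (auto intro!: sum.cong)
    finally show "(\<Sum>j=1..n. (\<integral>\<^sup>+ T. ennreal (t i j T) \<partial>?PJ)) = of_nat (n - 1) * ?F + ?R"
      using i by (simp add: add.commute)
  qed
  also have "\<dots> = of_nat (n * (n - 1)) * ?F + of_nat n * ?R"
    by (simp add: distrib_left mult.assoc)
  finally show ?thesis .
qed

end

end

text \<open>The expected proxy is an affine function of the pairwise risk with positive slope and
  finite constant term, so both have the same minimizers and \<open>minimizer_ranks\<close>
  applies.\<close>

theorem theorem11:
  fixes M :: "'a measure"
    and p :: "'a \<Rightarrow> 'b::finite \<Rightarrow> real"
    and loss :: "'b \<Rightarrow> 'b \<Rightarrow> real"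
    and h :: "'a \<Rightarrow> 'b"
    and n :: nat
    and s_opt :: "'a \<Rightarrow> real"
  assumes "joint_density M p"
    and "\<And>y y'. 0 \<le> loss y y'"
    and "h \<in> M \<rightarrow>\<^sub>M count_space UNIV"
    and "2 \<le> n"
    and "is_arg_min (E_proxy M p loss h n) (\<lambda>s. s \<in> borel_measurable M) s_opt"
  shows "AE (x, x') in input_distr M p \<Otimes>\<^sub>M input_distr M p.
           cond_risk p loss h x < cond_risk p loss h x' \<longrightarrow> s_opt x < s_opt x'"
proof -
  note prems = assms(1-3)
  let ?P = "input_distr M p" and ?r = "cond_risk p loss h"
  let ?C = "\<Sum>y\<in>UNIV. \<Sum>y'\<in>UNIV. loss y y'"
  let ?R = "\<integral>\<^sup>+ x. ennreal (?r x) * ennreal (ln 2) \<partial>?P"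
  interpret P: prob_space ?P by (rule prob_space_input_distr[OF assms(1)])
  have s_opt [measurable]: "s_opt \<in> borel_measurable M"
    and min: "\<And>s. s \<in> borel_measurable M \<Longrightarrow> E_proxy M p loss h n s_opt \<le> E_proxy M p loss h n s"
    using assms(5) by (auto simp: is_arg_min_def not_less)
  have "?R \<le> (\<integral>\<^sup>+ x. ennreal ?C * ennreal (ln 2) \<partial>?P)"
    by (intro nn_integral_mono mult_right_mono ennreal_leI cond_risk_le[OF prems]) auto
  also have "\<dots> < \<infinity>"
    using P.emeasure_space_1 by (simp add: ennreal_mult_less_top)
  \<comment> \<open>In \<open>ennreal\<close> only a finite summand can be cancelled from an
    inequality.\<close>
  finally have R_fin: "of_nat n * ?R \<noteq> \<infinity>" by (simp add: ennreal_mult_eq_top_iff)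
  have opt: "pairwise_risk ?P ?r s_opt \<le> pairwise_risk ?P ?r s" if s: "s \<in> borel_measurable M" for s
  proof -
    have "0 < ennreal (1 / (real n)\<^sup>2)" using assms(4) by simp
    then have "of_nat (n * (n - 1)) * pairwise_risk ?P ?r s_opt + of_nat n * ?R \<le>
        of_nat (n * (n - 1)) * pairwise_risk ?P ?r s + of_nat n * ?R"
      using min[OF s] unfolding E_proxy_eq_pairwise_risk[OF prems s]
        E_proxy_eq_pairwise_risk[OF prems s_opt]
      by (subst (asm) ennreal_mult_le_mult_iff) auto
    then have "(of_nat (n * (n - 1)) :: ennreal) * pairwise_risk ?P ?r s_opt \<le>
        of_nat (n * (n - 1)) * pairwise_risk ?P ?r s"
      using R_fin by (simp add: add.commute[of _ "of_nat n * ?R"] ennreal_add_left_cancel_le)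
    \<comment> \<open>Here \<open>2 <= n\<close> is essential: for \<open>n = 1\<close> only the
      diagonal remains and the proxy does not depend on the score.\<close>
    moreover have "(of_nat (n * (n - 1)) :: ennreal) \<noteq> 0"
      unfolding of_nat_eq_0_iff using assms(4) by simp
    ultimately show ?thesis
      by (subst (asm) ennreal_mult_le_mult_iff) (auto simp: ennreal_mult_eq_top_iff)
  qed
  show ?thesis
  proof (rule P.minimizer_ranks[where C = ?C])
    show "?r \<in> borel_measurable ?P"
      using cond_risk_measurable[OF prems] by simp
  qed (use opt cond_risk_nonneg[OF prems] cond_risk_le[OF prems] in auto)
qed

end
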